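(* Let $\epsilon>0$ and let $a=a(n)$ be a positive integer bias with $a\le(1-\epsilon)\ln\ln n$. Then there exists a strategy for CleverBreaker such that he a.a.s. wins the $(a:1)$-biased minimum degree-$1$ game on $E(K_n)$ against RandomMaker.
   Context: In an $(a:1)$-biased Maker-Breaker game on $E(K_n)$, Maker and Breaker alternately take turns claiming previously unclaimed (free) edges of the complete graph $K_n$; Maker goes first, Maker claims $a$ edges in each of his turns and Breaker claims $1$ edge in each of his turns, until no free edge is left (if fewer edges remain than a player should claim, he claims all of them). Maker wins the minimum degree-$1$ game if the graph on all $n$ vertices formed by the edges he claimed has no isolated vertex; otherwise Breaker wins. RandomMaker is a Maker each of whose moves (a move is the claiming of one edge) is a uniformly random edge among all currently free edges. CleverBreaker plays according to a strategy, i.e. a set of rules specifying what he does in every possible game situation. "Strategy" means a sequence of strategies, one for each $n$. "A.a.s." means with probability tending to $1$ as $n\to\infty$. *)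

theory Defs
  imports "HOL-Probability.Probability"
begin

definition complete_edges :: "nat \<Rightarrow> nat set set" where
  "complete_edges n = {e. e \<subseteq> {..<n} \<and> card e = 2}"

definition isolated_vertex :: "nat set set \<Rightarrow> nat \<Rightarrow> bool" where
  "isolated_vertex E v \<longleftrightarrow> (\<forall>e\<in>E. v \<notin> e)"

datatype player = Maker | Breaker

text \<open>
  A game situation is the complete record of the moves made so far, most recent move first;
  a move is the claiming of one edge.
\<close>

type_synonym situation = "(player \<times> nat set) list"

definition free_edges :: "nat \<Rightarrow> situation \<Rightarrow> nat set set" where
  "free_edges n h = complete_edges n - snd ` set h"

definition claimed_by :: "player \<Rightarrow> situation \<Rightarrow> nat set set" where
  "claimed_by p h = {e. (p, e) \<in> set h}"

text \<open>
  One round of the \<open>(a : 1)\<close> game consists of \<open>a\<close> moves of Maker followed by one move of Breaker.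
  The last round may be incomplete: play simply stops when no edge is free.
\<close>

definition to_move :: "nat \<Rightarrow> situation \<Rightarrow> player" where
  "to_move a h = (if length h mod (a + 1) < a then Maker else Breaker)"

type_synonym strategy = "situation \<Rightarrow> nat set"

definition breaker_strategy :: "nat \<Rightarrow> nat \<Rightarrow> strategy \<Rightarrow> bool" where
  "breaker_strategy n a S \<longleftrightarrow>
     (\<forall>h. to_move a h = Breaker \<and> free_edges n h \<noteq> {} \<longrightarrow> S h \<in> free_edges n h)"

definition random_maker_move :: "nat \<Rightarrow> nat \<Rightarrow> strategy \<Rightarrow> situation \<Rightarrow> situation pmf" where
  "random_maker_move n a S h =
     (if free_edges n h = {} then return_pmf h
      else case to_move a h of
        Maker \<Rightarrow> map_pmf (\<lambda>e. (Maker, e) # h) (pmf_of_set (free_edges n h))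
      | Breaker \<Rightarrow> return_pmf ((Breaker, S h) # h))"

primrec random_maker_play :: "nat \<Rightarrow> nat \<Rightarrow> strategy \<Rightarrow> nat \<Rightarrow> situation pmf" where
  "random_maker_play n a S 0 = return_pmf []"
| "random_maker_play n a S (Suc k) =
     bind_pmf (random_maker_play n a S k) (random_maker_move n a S)"

text \<open>
  Every move of a legal play claims exactly one free edge, so that play is over after
  as many moves as there are edges.
\<close>

definition random_maker_game :: "nat \<Rightarrow> nat \<Rightarrow> strategy \<Rightarrow> situation pmf" where
  "random_maker_game n a S = random_maker_play n a S (card (complete_edges n))"

definition maker_wins_min_degree_1 :: "nat \<Rightarrow> situation \<Rightarrow> bool" where
  "maker_wins_min_degree_1 n h \<longleftrightarrow>
     (\<forall>v<n. \<not> isolated_vertex (claimed_by Maker h) v)"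

definition breaker_wins_min_degree_1 :: "nat \<Rightarrow> situation \<Rightarrow> bool" where
  "breaker_wins_min_degree_1 n h \<longleftrightarrow> \<not> maker_wins_min_degree_1 n h"

end

theory Submission
  imports Defs "HOL-Real_Asymp.Real_Asymp"
begin

text \<open>
  Call a vertex untouched if Maker has claimed no edge at it. CleverBreaker always chases the
  untouched vertex with the fewest free edges left and claims one of these. He has won once
  some untouched vertex has no free edge, since then Breaker owns all of its edges.

  Over a complete chase starting from \<open>n - 1\<close> free edges, the expected number of hits of Maker on
  the chased vertex is about \<open>a * (1 + 2 + \<dots> + (n - 1)) / (n choose 2) = a\<close>, so a chase
  succeeds with probability about \<open>exp (- a) \<ge> (ln n) powr (- (1 - \<epsilon>))\<close>. A chase takes at most
  \<open>n\<close> rounds. Hence some chase is expected to succeed within about \<open>n * (ln n) powr (1 - \<epsilon>)\<close>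
  rounds, and \<open>R = n * (ln n) powr (1 - \<epsilon> / 2)\<close> rounds suffice with high probability.
  Until then only \<open>o (n * ln n)\<close> edges are claimed, too few for Maker to touch every
  vertex, so Breaker always has a vertex to chase.

  Both halves become one supermartingale (\<open>chase_failure_bound\<close>). The first summand is
  a multiple of \<open>1 / (u + 2)\<close>, where \<open>u\<close> counts the untouched vertices; \<open>1 / (u + 2)\<close> grows in
  expectation at most by a factor \<open>1 + O (1 / n)\<close> per move (\<open>untouched_potential_Maker\<close>) and so bounds the probability
  that the untouched vertices run out. The second is an upper bound for the expected length of
  the chase plus the number of rounds already played (\<open>projected_time\<close>), divided by
  \<open>R\<close>; by Markov's inequality it bounds the probability that the chase is still unfinished
  after \<open>R\<close> rounds. The sum is at least \<open>1\<close> whenever Breaker is not yet safe after \<open>R\<close> rounds,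
  and its initial value tends to \<open>0\<close>.
\<close>

section \<open>Positions and the chasing strategy\<close>

definition untouched :: "nat \<Rightarrow> situation \<Rightarrow> nat set" where
  "untouched n h = {v. v < n \<and> isolated_vertex (claimed_by Maker h) v}"

definition free_at :: "nat \<Rightarrow> situation \<Rightarrow> nat \<Rightarrow> nat set set" where
  "free_at n h v = {e \<in> free_edges n h. v \<in> e}"

definition target :: "nat \<Rightarrow> situation \<Rightarrow> nat" where
  "target n h = arg_min_on (\<lambda>v. card (free_at n h v)) (untouched n h)"

definition deficit :: "nat \<Rightarrow> situation \<Rightarrow> nat" where
  "deficit n h = card (free_at n h (target n h))"

text \<open>
  The choice depends only on the position, so an abandoned chase needs no bookkeeping: work done
  earlier at another vertex can only make that vertex a better target. If the target has no free
  edge the game is already decided, or no untouched vertex exists, and any legal move will do.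
\<close>

definition chase :: "nat \<Rightarrow> strategy" where
  "chase n h = (SOME e. e \<in> (if free_at n h (target n h) = {} then free_edges n h
                             else free_at n h (target n h)))"

text \<open>
  Breaker's win is already certain: no future move of Maker can reach \<open>v\<close>.
\<close>

definition secured :: "nat \<Rightarrow> situation \<Rightarrow> bool" where
  "secured n h \<longleftrightarrow> (\<exists>v\<in>untouched n h. free_at n h v = {})"

lemma finite_complete_edges [simp]: "finite (complete_edges n)"
  by (rule finite_subset[of _ "Pow {..<n}"]) (auto simp: complete_edges_def)

lemma card_complete_edges: "card (complete_edges n) = n choose 2"
  unfolding complete_edges_def using n_subsets[of "{..<n}" 2] by simp

lemma card_complete_edges_at_le: "card {e \<in> complete_edges n. v \<in> e} \<le> n - 1"
proof (cases "v < n")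
  case True
  have "{e \<in> complete_edges n. v \<in> e} \<subseteq> (\<lambda>u. {v, u}) ` ({..<n} - {v})"
  proof
    fix e assume "e \<in> {e \<in> complete_edges n. v \<in> e}"
    then have e: "e \<subseteq> {..<n}" "card e = 2" "v \<in> e" by (auto simp: complete_edges_def)
    from e(2) obtain x y where "e = {x, y}" "x \<noteq> y" by (auto simp: card_2_iff)
    with e show "e \<in> (\<lambda>u. {v, u}) ` ({..<n} - {v})" by auto
  qed
  then have "card {e \<in> complete_edges n. v \<in> e} \<le> card ({..<n} - {v})"
    by (rule surj_card_le[rotated]) simp
  with True show ?thesis by simp
next
  case False
  then have "{e \<in> complete_edges n. v \<in> e} = {}" by (auto simp: complete_edges_def)
  then show ?thesis by (simp only: card.empty)
qed

lemma finite_free_edges [simp]: "finite (free_edges n h)"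
  by (simp add: free_edges_def)

lemma finite_untouched [simp]: "finite (untouched n h)"
  by (simp add: untouched_def)

lemma finite_free_at [simp]: "finite (free_at n h v)"
  by (simp add: free_at_def)

lemma free_edges_Cons [simp]: "free_edges n ((p, e) # h) = free_edges n h - {e}"
  by (auto simp: free_edges_def)

lemma free_at_Cons [simp]: "free_at n ((p, e) # h) v = free_at n h v - {e}"
  by (auto simp: free_at_def)

lemma untouched_Breaker [simp]: "untouched n ((Breaker, e) # h) = untouched n h"
  by (auto simp: untouched_def claimed_by_def)

lemma untouched_Maker [simp]: "untouched n ((Maker, e) # h) = untouched n h - e"
  by (auto simp: untouched_def claimed_by_def isolated_vertex_def)

lemma card_free_at_le: "card (free_at n h v) \<le> n - 1"
proof -
  have "card (free_at n h v) \<le> card {e \<in> complete_edges n. v \<in> e}"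
    by (intro card_mono) (auto simp: free_at_def free_edges_def)
  with card_complete_edges_at_le[of n v] show ?thesis by linarith
qed

lemma deficit_le: "deficit n h \<le> n - 1"
  unfolding deficit_def by (rule card_free_at_le)

lemma target_untouched: "untouched n h \<noteq> {} \<Longrightarrow> target n h \<in> untouched n h"
  unfolding target_def by (rule arg_min_if_finite) simp

lemma deficit_le_free_at: "v \<in> untouched n h \<Longrightarrow> deficit n h \<le> card (free_at n h v)"
  unfolding deficit_def target_def
  using arg_min_if_finite(2)[of "untouched n h" "\<lambda>v. card (free_at n h v)"] by force

lemma secured_iff: "secured n h \<longleftrightarrow> untouched n h \<noteq> {} \<and> deficit n h = 0"
proof
  assume "secured n h"
  then obtain v where "v \<in> untouched n h" "free_at n h v = {}" by (auto simp: secured_def)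
  with deficit_le_free_at[of v n h] show "untouched n h \<noteq> {} \<and> deficit n h = 0" by auto
next
  assume "untouched n h \<noteq> {} \<and> deficit n h = 0"
  with target_untouched[of n h] show "secured n h"
    by (auto simp: secured_def deficit_def)
qed

lemma chase_in_free_at:
  assumes "deficit n h > 0"
  shows "chase n h \<in> free_at n h (target n h)"
proof -
  have ne: "free_at n h (target n h) \<noteq> {}" using assms by (auto simp: deficit_def)
  then have "chase n h = (SOME e. e \<in> free_at n h (target n h))" by (simp add: chase_def)
  with ne show ?thesis by (simp add: some_in_eq)
qed

lemma chase_in_free:
  assumes "free_edges n h \<noteq> {}"
  shows "chase n h \<in> free_edges n h"
proof (cases "deficit n h = 0")
  case True
  then have "chase n h = (SOME e. e \<in> free_edges n h)" by (simp add: chase_def deficit_def)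
  with assms show ?thesis by (simp add: some_in_eq)
next
  case False
  then show ?thesis using chase_in_free_at[of n h] by (simp add: free_at_def)
qed

lemma breaker_strategy_chase: "breaker_strategy n a (chase n)"
  by (simp add: breaker_strategy_def chase_in_free)

lemma secured_Maker: "e \<in> free_edges n h \<Longrightarrow> secured n h \<Longrightarrow> secured n ((Maker, e) # h)"
  by (auto simp: secured_def) (auto simp: free_at_def)

lemma secured_Breaker: "secured n h \<Longrightarrow> secured n ((Breaker, e) # h)"
  by (auto simp: secured_def)

lemma not_secured_if_maker_wins:
  assumes "maker_wins_min_degree_1 n h"
  shows "\<not> secured n h"
  using assms by (auto simp: maker_wins_min_degree_1_def secured_def untouched_def)


section \<open>Supermartingales along a play\<close>

text \<open>
  With finite supports, every real function is integrable and expectations of plays are sums.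
\<close>

lemma finite_set_random_maker_move [simp]: "finite (set_pmf (random_maker_move n a S h))"
  by (auto simp: random_maker_move_def split: player.split)

lemma finite_set_random_maker_play [simp]: "finite (set_pmf (random_maker_play n a S k))"
  by (induction k) auto

text \<open>
  Legal play claims one new edge per move, so both the player to move and the number of
  edges that RandomMaker chooses from are determined by the number of moves.
\<close>

lemma play_length_free:
  assumes S: "breaker_strategy n a S" and "k \<le> n choose 2" and "h \<in> set_pmf (random_maker_play n a S k)"
  shows "length h = k \<and> card (free_edges n h) = (n choose 2) - k"
  using assms(2,3)
proof (induction k arbitrary: h)
  case 0
  then show ?case by (simp add: free_edges_def card_complete_edges)
next
  case (Suc k)
  then obtain g where g: "g \<in> set_pmf (random_maker_play n a S k)"
    and h: "h \<in> set_pmf (random_maker_move n a S g)" by auto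
  from Suc.IH[OF _ g] Suc.prems have IH: "length g = k" "card (free_edges n g) = (n choose 2) - k"
    by auto
  with Suc.prems have ne: "free_edges n g \<noteq> {}" by auto
  have "\<exists>p e. e \<in> free_edges n g \<and> h = (p, e) # g"
  proof (cases "to_move a g")
    case Maker
    with h ne show ?thesis by (auto simp: random_maker_move_def)
  next
    case Breaker
    with S ne have "S g \<in> free_edges n g" by (simp add: breaker_strategy_def)
    with h ne Breaker show ?thesis by (auto simp: random_maker_move_def)
  qed
  then obtain p e where "e \<in> free_edges n g" "h = (p, e) # g" by auto
  with IH show ?case by simp
qed

lemma expectation_play_Suc:
  fixes f :: "situation \<Rightarrow> real"
  shows "measure_pmf.expectation (random_maker_play n a S (Suc k)) f =
    measure_pmf.expectation (random_maker_play n a S k)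
      (\<lambda>h. measure_pmf.expectation (random_maker_move n a S h) f)"
  by (simp add: pmf_expectation_bind[of "set_pmf (random_maker_play n a S k)"]
       integral_measure_pmf[of "set_pmf (random_maker_play n a S k)"])

text \<open>
  Martingale arguments are reduced here to two deterministic inequalities, one per
  player: a Maker move replaces \<open>f\<close> by its average over the free edges.
\<close>

lemma play_supermartingale:
  fixes f :: "nat \<Rightarrow> situation \<Rightarrow> real"
  assumes S: "breaker_strategy n a S" and "k0 \<le> k1" and "k1 \<le> n choose 2"
    and maker: "\<And>k h. k0 \<le> k \<Longrightarrow> k < k1 \<Longrightarrow> k mod (a + 1) < a \<Longrightarrow>
        card (free_edges n h) = (n choose 2) - k \<Longrightarrow>
        (\<Sum>e\<in>free_edges n h. f (Suc k) ((Maker, e) # h)) \<le> real (card (free_edges n h)) * f k h"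
    and breaker: "\<And>k h. k0 \<le> k \<Longrightarrow> k < k1 \<Longrightarrow> k mod (a + 1) = a \<Longrightarrow>
        f (Suc k) ((Breaker, S h) # h) \<le> f k h"
  shows "measure_pmf.expectation (random_maker_play n a S k1) (f k1)
       \<le> measure_pmf.expectation (random_maker_play n a S k0) (f k0)"
  using \<open>k0 \<le> k1\<close>
proof (induction rule: inc_induct)
  case base
  show ?case by simp
next
  case (step k)
  have "measure_pmf.expectation (random_maker_move n a S h) (f (Suc k)) \<le> f k h"
    if h: "h \<in> set_pmf (random_maker_play n a S k)" for h
  proof -
    have len: "length h = k" and card: "card (free_edges n h) = (n choose 2) - k"
      using play_length_free[OF S _ h] step.hyps assms(3) by auto
    have ne: "free_edges n h \<noteq> {}" using card step.hyps assms(3) by auto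
    show ?thesis
    proof (cases "k mod (a + 1) < a")
      case True
      have "measure_pmf.expectation (random_maker_move n a S h) (f (Suc k))
          = (\<Sum>e\<in>free_edges n h. f (Suc k) ((Maker, e) # h)) / real (card (free_edges n h))"
        using True len ne by (simp add: random_maker_move_def to_move_def integral_pmf_of_set)
      also have "\<dots> \<le> f k h"
        using maker[OF _ _ True card] step.hyps ne
        by (simp add: divide_le_eq card_gt_0_iff mult.commute)
      finally show ?thesis .
    next
      case False
      then have "k mod (a + 1) = a"
        by (metis Suc_eq_plus1 less_SucE mod_less_divisor zero_less_Suc)
      with breaker[of k h] len ne step.hyps show ?thesis
        by (simp add: random_maker_move_def to_move_def)
    qed
  qed
  then have "measure_pmf.expectation (random_maker_play n a S (Suc k)) (f (Suc k))
      \<le> measure_pmf.expectation (random_maker_play n a S k) (f k)"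
    unfolding expectation_play_Suc
    by (intro integral_mono_AE integrable_measure_pmf_finite) (auto simp: AE_measure_pmf_iff)
  with step.IH show ?case by linarith
qed

text \<open>
  A secured vertex stays secured. This is why only an initial segment of the game has to be
  analysed, in which almost all edges are still free.
\<close>

lemma prob_not_secured_antimono:
  assumes S: "breaker_strategy n a S" and "k0 \<le> k1" and "k1 \<le> n choose 2"
  shows "measure_pmf.prob (random_maker_play n a S k1) {h. \<not> secured n h}
       \<le> measure_pmf.prob (random_maker_play n a S k0) {h. \<not> secured n h}"
proof -
  have "(\<Sum>e\<in>free_edges n h. indicator {h. \<not> secured n h} ((Maker, e) # h))
      \<le> real (card (free_edges n h)) * (indicator {h. \<not> secured n h} h :: real)" for h
    by (rule sum_bounded_above) (auto simp: indicator_def intro: secured_Maker)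
  moreover have "(indicator {h. \<not> secured n h} ((Breaker, S h) # h) :: real)
      \<le> indicator {h. \<not> secured n h} h" for h
    by (auto simp: indicator_def intro: secured_Breaker)
  ultimately have "measure_pmf.expectation (random_maker_play n a S k1) (indicator {h. \<not> secured n h} :: _ \<Rightarrow> real)
       \<le> measure_pmf.expectation (random_maker_play n a S k0) (indicator {h. \<not> secured n h})"
    by (intro play_supermartingale[OF assms, where f = "\<lambda>_. indicator {h. \<not> secured n h}"])
  then show ?thesis by simp
qed


section \<open>Maker leaves vertices untouched\<close>

text \<open>
  A random edge hits a given untouched vertex with probability at most \<open>n / F\<close>, where \<open>F\<close> is the
  number of free edges. The number \<open>u\<close> of untouched vertices therefore drops by at most \<open>u n / F\<close>
  in expectation. The shift by \<open>2\<close> absorbs that one edge may hit two vertices: it turns the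
  increment \<open>t / ((u - t + 2) (u + 2))\<close> into at most \<open>t / (u (u + 2))\<close>, which is linear in the
  number \<open>t\<close> of hits. So a first moment suffices where a direct count of untouched vertices
  would call for a variance estimate.
\<close>

lemma untouched_potential_Maker:
  assumes q: "real n \<le> q * real (card (free_edges n h))"
  shows "(\<Sum>e\<in>free_edges n h. 1 / (real (card (untouched n ((Maker, e) # h))) + 2))
     \<le> real (card (free_edges n h)) * ((1 + q) / (real (card (untouched n h)) + 2))"
proof -
  define U where "U = untouched n h"
  define u where "u = real (card U)"
  have [simp]: "finite U" by (simp add: U_def)
  have one: "1 / (real (card (U - e)) + 2) \<le> 1 / (u + 2) + real (card (U \<inter> e)) / (u * (u + 2))"
    if e: "e \<in> free_edges n h" for e
  proof (cases "U = {}")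
    case False
    then have u: "u > 0" by (simp add: u_def card_gt_0_iff)
    have "card e = 2" "finite e"
      using e by (auto simp: free_edges_def complete_edges_def intro: finite_subset)
    then have t: "card (U \<inter> e) \<le> 2" by (metis card_mono inf_le2)
    have eq: "real (card (U - e)) = u - real (card (U \<inter> e))"
    proof -
      have "card (U - e) + card (U \<inter> e) = card U"
        by (metis Int_commute \<open>finite U\<close> \<open>finite e\<close> add.commute card_Diff_subset_Int card_mono finite_Int inf_le1 le_add_diff_inverse)
      then show ?thesis by (simp add: u_def)
    qed
    define t where "t = real (card (U \<inter> e))"
    have "0 \<le> t" "t \<le> 2" using t by (auto simp: t_def)
    then have "1 / (u - t + 2) - 1 / (u + 2) = t / ((u - t + 2) * (u + 2))"
      using u by (subst diff_frac_eq) auto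
    then have "1 / (u - t + 2) = 1 / (u + 2) + t / ((u - t + 2) * (u + 2))" by linarith
    also have "t / ((u - t + 2) * (u + 2)) \<le> t / (u * (u + 2))"
      using u \<open>0 \<le> t\<close> \<open>t \<le> 2\<close> by (intro divide_left_mono mult_right_mono mult_pos_pos) auto
    finally show ?thesis by (simp add: eq t_def)
  qed (simp add: u_def)
  \<comment> \<open>Double counting of the incidences between untouched vertices and free edges.\<close>
  have hits: "(\<Sum>e\<in>free_edges n h. real (card (U \<inter> e))) \<le> u * real n"
  proof -
    have "(\<Sum>e\<in>free_edges n h. card (U \<inter> e)) = (\<Sum>v\<in>U. card (free_at n h v))"
      using sum_multicount_gen[of "free_edges n h" U "\<lambda>e v. v \<in> e" "\<lambda>v. card (free_at n h v)"]
      by (simp add: free_at_def Int_def)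
    also have "\<dots> \<le> card U * n"
      using card_free_at_le[of n h] by (intro sum_bounded_above[where 'a=nat, simplified]) (meson diff_le_self le_trans)
    finally show ?thesis unfolding u_def by (metis of_nat_le_iff of_nat_mult of_nat_sum)
  qed
  have "(\<Sum>e\<in>free_edges n h. 1 / (real (card (U - e)) + 2))
      \<le> (\<Sum>e\<in>free_edges n h. 1 / (u + 2) + real (card (U \<inter> e)) / (u * (u + 2)))"
    by (intro sum_mono one)
  also have "\<dots> = card (free_edges n h) / (u + 2)
      + (\<Sum>e\<in>free_edges n h. real (card (U \<inter> e))) / (u * (u + 2))"
    by (simp add: sum.distrib sum_divide_distrib)
  also have "(\<Sum>e\<in>free_edges n h. real (card (U \<inter> e))) / (u * (u + 2)) \<le> u * real n / (u * (u + 2))"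
    using hits by (intro divide_right_mono) (auto simp: u_def)
  also have "u * real n / (u * (u + 2)) \<le> real n / (u + 2)"
    by (cases "u = 0") (auto simp: u_def)
  also have "\<dots> \<le> q * real (card (free_edges n h)) / (u + 2)"
    using q by (intro divide_right_mono) (auto simp: u_def)
  finally show ?thesis
    by (simp add: U_def u_def add_divide_distrib algebra_simps)
qed


section \<open>The expected length of the chase\<close>

text \<open>
  The chased vertex has \<open>d\<close> free edges and Maker has \<open>j\<close> moves left in this round. The exposure is
  the sum, over all moves that Maker makes until the chase succeeds, of the number of edges that
  would ruin it: \<open>d\<close> for each of the \<open>j\<close> moves of the current round, and \<open>i\<close> for each of the \<open>a\<close>
  moves of the later rounds, which Maker meets with \<open>i = d - 1, d - 2, \<dots>, 1\<close> free edges.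
\<close>

definition exposure :: "nat \<Rightarrow> nat \<Rightarrow> nat \<Rightarrow> nat" where
  "exposure a d j = a * (d choose 2) + j * d"

text \<open>
  An upper bound for the expected number of rounds until success. The chase survives with
  probability at least \<open>exp (- lam * exposure)\<close> for a suitable \<open>lam\<close> slightly larger than the
  reciprocal of the number of free edges. If it survives it lasts \<open>d\<close> rounds, and \<open>C\<close> is the
  price of having to start over.
\<close>

definition chase_time :: "real \<Rightarrow> real \<Rightarrow> nat \<Rightarrow> nat \<Rightarrow> nat \<Rightarrow> real" where
  "chase_time C lam a d j = C * (1 - exp (- lam * real (exposure a d j))) + real d"

lemma exposure_Suc_0: "exposure a (Suc d) 0 = exposure a d a"
  by (simp add: exposure_def numeral_2_eq_2 algebra_simps)

lemma exposure_mono: "d \<le> d' \<Longrightarrow> j \<le> j' \<Longrightarrow> exposure a d j \<le> exposure a d' j'"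
  unfolding exposure_def by (intro add_mono mult_mono binomial_right_mono) auto

lemma exposure_le:
  assumes "d \<le> n - 1" "j \<le> a"
  shows "exposure a d j \<le> a * (n choose 2)"
proof (cases n)
  case 0
  with assms show ?thesis by (simp add: exposure_def)
next
  case (Suc m)
  have "exposure a d j \<le> exposure a m a" using assms Suc by (intro exposure_mono) auto
  also have "\<dots> = a * (n choose 2)"
    unfolding exposure_Suc_0[symmetric] Suc by (simp add: exposure_def)
  finally show ?thesis .
qed

lemma chase_time_mono:
  assumes "C \<ge> 0" "lam \<ge> 0" "d \<le> d'" "j \<le> j'"
  shows "chase_time C lam a d j \<le> chase_time C lam a d' j'"
proof -
  have "lam * real (exposure a d j) \<le> lam * real (exposure a d' j')"
    using assms exposure_mono by (intro mult_left_mono) auto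
  then show ?thesis unfolding chase_time_def
    using assms by (intro add_mono mult_left_mono) auto
qed

lemma chase_time_nonneg: "C \<ge> 0 \<Longrightarrow> lam \<ge> 0 \<Longrightarrow> chase_time C lam a d j \<ge> 0"
  by (simp add: chase_time_def)

lemma chase_time_le: "C \<ge> 0 \<Longrightarrow> chase_time C lam a d j \<le> C + real d"
  by (simp add: chase_time_def algebra_simps)

text \<open>
  A Maker move hits the target with probability \<open>d / F\<close>, and even then the new target has at
  most \<open>n - 1\<close> free edges. The hypothesis \<open>restart\<close> says that the price \<open>C\<close>, weighted
  with the success probability of a fresh chase, pays for its \<open>n\<close> rounds; it makes
  \<open>chase_time\<close> at the worst position at most \<open>C\<close>. The hypothesis \<open>survive\<close> then lets the
  factor \<open>1 - d / F\<close> absorb the difference of the exposures before and after the move.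
\<close>

lemma chase_time_Maker:
  assumes "C \<ge> 0" "lam \<ge> 0" "d < n" "Suc j \<le> a" "real d \<le> F" "F > 0"
    and survive: "exp (- lam * real d) \<le> 1 - real d / F"
    and restart: "real n \<le> C * exp (- lam * real (a * (n choose 2)))"
  shows "(F - real d) * chase_time C lam a d j + real d * chase_time C lam a (n - 1) j
       \<le> F * chase_time C lam a d (Suc j)"
proof -
  define x where "x d j = exp (- lam * real (exposure a d j))" for d j
  have T: "chase_time C lam a d j = C * (1 - x d j) + real d" for d j
    by (simp add: chase_time_def x_def)
  have "exposure a (n - 1) j \<le> a * (n choose 2)"
    using assms by (intro exposure_le) auto
  then have "exp (- lam * real (a * (n choose 2))) \<le> x (n - 1) j"
    unfolding x_def using assms by (simp add: mult_left_mono del: of_nat_mult)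
  then have "C * exp (- lam * real (a * (n choose 2))) \<le> C * x (n - 1) j"
    using assms by (intro mult_left_mono)
  with restart have top: "chase_time C lam a (n - 1) j \<le> C"
    using assms by (simp add: T algebra_simps of_nat_diff)
  have "x d (Suc j) = exp (- lam * real d) * x d j"
    by (simp add: x_def exposure_def exp_add[symmetric] algebra_simps)
  also have "\<dots> \<le> (1 - real d / F) * x d j"
    using survive by (intro mult_right_mono) (auto simp: x_def)
  finally have "F * x d (Suc j) \<le> (F - real d) * x d j"
    using assms by (simp add: field_simps)
  then have *: "C * (F * x d (Suc j)) \<le> C * ((F - real d) * x d j)"
    using assms by (intro mult_left_mono)
  have "real d * chase_time C lam a (n - 1) j \<le> real d * C"
    using top by (intro mult_left_mono) auto
  then have "(F - real d) * chase_time C lam a d j + real d * chase_time C lam a (n - 1) j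
     \<le> (F - real d) * (C * (1 - x d j) + real d) + real d * C" by (simp add: T)
  also have "\<dots> = F * C - C * ((F - real d) * x d j) + (F - real d) * real d"
    by (simp add: algebra_simps)
  also have "\<dots> \<le> F * C - C * (F * x d (Suc j)) + F * real d"
    using * assms by (intro add_mono diff_mono mult_right_mono) auto
  also have "\<dots> = F * chase_time C lam a d (Suc j)" by (simp add: T algebra_simps)
  finally show ?thesis .
qed

definition contested :: "nat \<Rightarrow> situation \<Rightarrow> bool" where
  "contested n h \<longleftrightarrow> untouched n h \<noteq> {} \<and> deficit n h > 0"

text \<open>
  An upper bound for the expected total number of rounds at success, given the position after \<open>k\<close> moves. It is cut off
  to \<open>0\<close> both at success and when Maker has touched every vertex. The latter does not break the
  supermartingale property, since it only decreases a nonnegative function; that event is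
  charged to the other summand of the potential instead.
\<close>

definition projected_time :: "nat \<Rightarrow> nat \<Rightarrow> real \<Rightarrow> real \<Rightarrow> nat \<Rightarrow> situation \<Rightarrow> real" where
  "projected_time n a C lam k h =
     (if contested n h
      then chase_time C lam a (deficit n h) (a - k mod (a + 1)) + real (k div (a + 1)) else 0)"

lemma projected_time_nonneg: "C \<ge> 0 \<Longrightarrow> lam \<ge> 0 \<Longrightarrow> projected_time n a C lam k h \<ge> 0"
  by (simp add: projected_time_def chase_time_nonneg)

lemma projected_time_le:
  assumes "C \<ge> 0" "lam \<ge> 0" "untouched n h \<noteq> {} \<Longrightarrow> deficit n h \<le> d"
  shows "projected_time n a C lam k h \<le> chase_time C lam a d (a - k mod (a + 1)) + real (k div (a + 1))"
  using assms by (auto simp: projected_time_def contested_def chase_time_mono chase_time_nonneg)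

lemma not_contested_Maker:
  assumes "\<not> contested n h" "e \<in> free_edges n h"
  shows "\<not> contested n ((Maker, e) # h)"
proof (cases "untouched n h = {}")
  case False
  with assms have "secured n h" by (auto simp: contested_def secured_iff)
  with assms have "secured n ((Maker, e) # h)" by (intro secured_Maker)
  then show ?thesis by (simp add: secured_iff contested_def)
qed (simp add: contested_def)

lemma not_contested_Breaker:
  assumes "\<not> contested n h"
  shows "\<not> contested n ((Breaker, e) # h)"
proof (cases "untouched n h = {}")
  case False
  with assms have "secured n h" by (auto simp: contested_def secured_iff)
  then have "secured n ((Breaker, e) # h)" by (intro secured_Breaker)
  then show ?thesis by (simp add: secured_iff contested_def)
qed (simp add: contested_def)

lemma projected_time_Maker:
  assumes "C \<ge> 0" "lam \<ge> 0" "k mod (a + 1) < a"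
    and survive: "\<And>d. d < n \<Longrightarrow> exp (- lam * real d) \<le> 1 - real d / real (card (free_edges n h))"
    and restart: "real n \<le> C * exp (- lam * real (a * (n choose 2)))"
  shows "(\<Sum>e\<in>free_edges n h. projected_time n a C lam (Suc k) ((Maker, e) # h))
       \<le> real (card (free_edges n h)) * projected_time n a C lam k h"
proof (cases "contested n h")
  case False
  then show ?thesis by (simp add: projected_time_def not_contested_Maker)
next
  case True
  define v where "v = target n h"
  define d where "d = deficit n h"
  define F where "F = card (free_edges n h)"
  define j where "j = a - Suc k mod (a + 1)"
  define r where "r = real (Suc k div (a + 1))"
  have v: "v \<in> untouched n h" using True target_untouched by (auto simp: contested_def v_def)
  then have n: "n > 0" by (auto simp: untouched_def)
  have d: "d < n" using deficit_le[of n h] n by (auto simp: d_def)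
  have Suc_mod: "Suc k mod (a + 1) = Suc (k mod (a + 1))" "Suc k div (a + 1) = k div (a + 1)"
    using assms(3) by (auto simp: mod_Suc div_Suc)
  then have j: "a - k mod (a + 1) = Suc j" using assms(3) by (simp add: j_def)
  define A where "A = chase_time C lam a d j + r"
  define B where "B = chase_time C lam a (n - 1) j + r"
  have dF: "d \<le> F" unfolding d_def F_def deficit_def free_at_def by (intro card_mono) auto
  have "d > 0" using True by (simp add: d_def contested_def)
  with dF have F: "F > 0" by simp
  have "projected_time n a C lam (Suc k) ((Maker, e) # h) \<le> (if v \<in> e then B else A)" for e
  proof (cases "v \<in> e")
    case True
    then show ?thesis
      using projected_time_le[OF assms(1,2), of n "(Maker, e) # h" "n - 1" a "Suc k"] deficit_le[of n "(Maker, e) # h"]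
      by (simp add: B_def j_def r_def)
  next
    case False
    then have "v \<in> untouched n ((Maker, e) # h)" using v by simp
    then have "deficit n ((Maker, e) # h) \<le> card (free_at n h v - {e})"
      using deficit_le_free_at by fastforce
    also have "\<dots> \<le> d" unfolding d_def deficit_def v_def by (intro card_mono) auto
    finally show ?thesis using False
      using projected_time_le[OF assms(1,2), of n "(Maker, e) # h" d a "Suc k"]
      by (simp add: A_def j_def r_def)
  qed
  then have "(\<Sum>e\<in>free_edges n h. projected_time n a C lam (Suc k) ((Maker, e) # h))
     \<le> (\<Sum>e\<in>free_edges n h. if v \<in> e then B else A)" by (intro sum_mono)
  also have "\<dots> = real (card {e \<in> free_edges n h. v \<in> e}) * B + real (card {e \<in> free_edges n h. v \<notin> e}) * A"
    by (simp add: sum.If_cases Int_def)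
  also have "card {e \<in> free_edges n h. v \<in> e} = d" by (simp add: d_def deficit_def free_at_def v_def)
  also have "{e \<in> free_edges n h. v \<notin> e} = free_edges n h - free_at n h v"
    by (auto simp: free_at_def)
  also have "card (free_edges n h - free_at n h v) = F - d"
    by (subst card_Diff_subset) (auto simp: free_at_def F_def d_def deficit_def v_def)
  also have "real d * B + real (F - d) * A
     = ((real F - real d) * chase_time C lam a d j + real d * chase_time C lam a (n - 1) j) + real F * r"
    using dF by (simp add: A_def B_def of_nat_diff algebra_simps)
  also have "\<dots> \<le> real F * chase_time C lam a d (Suc j) + real F * r"
    using assms d dF F Suc_mod j
    by (intro add_right_mono chase_time_Maker) (auto simp: F_def)
  also have "\<dots> = real F * projected_time n a C lam k h"
    using True unfolding projected_time_def j r_def Suc_mod(2) by (simp add: d_def algebra_simps)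
  finally show ?thesis by (simp add: F_def)
qed

text \<open>
  Breaker's move at the target costs one round and lowers \<open>chase_time\<close> by one, since the exposure
  is the same for \<open>Suc d\<close> free edges at the end of a round and for \<open>d\<close> free edges at the start
  of the next (\<open>exposure_Suc_0\<close>).
\<close>

lemma projected_time_Breaker:
  assumes "C \<ge> 0" "lam \<ge> 0" "k mod (a + 1) = a"
  shows "projected_time n a C lam (Suc k) ((Breaker, chase n h) # h) \<le> projected_time n a C lam k h"
proof (cases "contested n h")
  case False
  then show ?thesis by (simp add: projected_time_def not_contested_Breaker)
next
  case True
  define v where "v = target n h"
  let ?h = "(Breaker, chase n h) # h"
  have v: "v \<in> untouched n ?h" using True target_untouched by (auto simp: contested_def v_def)
  obtain d where d: "deficit n h = Suc d" using True by (auto simp: contested_def gr0_conv_Suc)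
  have "deficit n ?h \<le> card (free_at n h v - {chase n h})"
    using deficit_le_free_at[OF v] by simp
  also have "\<dots> = d"
    using chase_in_free_at[of n h] d by (simp add: v_def card_Diff_singleton deficit_def)
  finally have "projected_time n a C lam (Suc k) ?h
      \<le> chase_time C lam a d (a - Suc k mod (a + 1)) + real (Suc k div (a + 1))"
    by (intro projected_time_le assms)
  also have "\<dots> = chase_time C lam a (Suc d) 0 + real (k div (a + 1))"
    using assms(3) by (simp add: mod_Suc div_Suc chase_time_def exposure_Suc_0)
  also have "\<dots> = projected_time n a C lam k h"
    using True d assms(3) by (simp add: projected_time_def)
  finally show ?thesis .
qed


section \<open>A bound on the failure probability\<close>

text \<open>
  The multiplier \<open>1 / L\<close> works simultaneously for all \<open>x\<close> as long as \<open>L\<close> is at most the number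
  of free edges not ruining the chase; this determines \<open>lam\<close> below.
\<close>

lemma exp_survival:
  fixes x F L :: real
  assumes "0 \<le> x" "0 < L" "L \<le> F - x"
  shows "exp (- (1 / L) * x) \<le> 1 - x / F"
proof -
  have "F / (F - x) = 1 + x / (F - x)" using assms by (simp add: field_simps)
  also have "\<dots> \<le> 1 + x / L" using assms by (intro add_left_mono divide_left_mono) auto
  also have "\<dots> \<le> exp (x / L)" by (rule exp_ge_add_one_self)
  finally have "1 / exp (x / L) \<le> 1 / (F / (F - x))"
    using assms by (intro divide_left_mono mult_pos_pos divide_pos_pos) auto
  then have "exp (- (x / L)) \<le> 1 / (F / (F - x))" by (simp add: exp_minus inverse_eq_divide)
  also have "\<dots> = 1 - x / F" using assms by (simp add: field_simps)
  finally show ?thesis by simp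
qed

text \<open>
  Here \<open>K\<close> is the number of moves in the first \<open>R\<close> rounds and \<open>N - K\<close> a lower bound for the number
  of free edges during these. The first term bounds the probability that Maker touches every
  vertex; the second is Markov's inequality for the length of the chase.
\<close>

lemma chase_failure_bound:
  fixes n a R :: nat
  defines "K \<equiv> (a + 1) * R"
  defines "N \<equiv> n choose 2"
  assumes "R > 0" and "K + n < N"
  shows "measure_pmf.prob (random_maker_game n a (chase n)) {h. maker_wins_min_degree_1 n h}
     \<le> 2 * (1 + real n / real (N - K)) ^ K / (real n + 2)
       + (real n * exp (real a * real N / real (N - K - n)) + real n) / real R"
proof -
  define q where "q = real n / real (N - K)"
  define lam where "lam = 1 / real (N - K - n)"
  \<comment> \<open>The exposure of a fresh chase is at most \<open>a * N\<close>; \<open>C\<close> is the least price meeting \<open>restart\<close>.\<close>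
  define C where "C = real n * exp (lam * real (a * N))"
  define f where "f k h = 2 * (1 + q) ^ (K - k) * (1 / (real (card (untouched n h)) + 2))
      + projected_time n a C lam k h / real R" for k h
  have pos: "q \<ge> 0" "lam \<ge> 0" "C \<ge> 0" by (auto simp: q_def lam_def C_def)
  let ?P = "random_maker_play n a (chase n)"
  have "measure_pmf.expectation (?P K) (f K) \<le> measure_pmf.expectation (?P 0) (f 0)"
  proof (rule play_supermartingale[OF breaker_strategy_chase])
    show "K \<le> n choose 2" using assms by simp
    fix k h assume k: "k < K"
    {
      assume mod: "k mod (a + 1) < a" and card: "card (free_edges n h) = (n choose 2) - k"
      let ?F = "card (free_edges n h)"
      have F: "N - K \<le> ?F" using card k by (simp add: N_def)
      have "real n = q * real (N - K)" using assms(4) by (simp add: q_def)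
      also have "\<dots> \<le> q * real ?F" using F pos by (intro mult_left_mono) auto
      finally have 1: "(\<Sum>e\<in>free_edges n h. 1 / (real (card (untouched n ((Maker, e) # h))) + 2))
           \<le> real ?F * ((1 + q) / (real (card (untouched n h)) + 2))"
        by (rule untouched_potential_Maker)
      have "K - k = Suc (K - Suc k)" using k by simp
      then have pow: "(1 + q) ^ (K - k) = (1 + q) * (1 + q) ^ (K - Suc k)" by simp
      have 2: "(\<Sum>e\<in>free_edges n h. projected_time n a C lam (Suc k) ((Maker, e) # h))
           \<le> real ?F * projected_time n a C lam k h"
      proof (rule projected_time_Maker[OF pos(3,2) mod])
        show "real n \<le> C * exp (- lam * real (a * (n choose 2)))"
          by (simp add: C_def N_def mult.assoc exp_add[symmetric])
        fix d assume "d < n"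
        with F assms(4) show "exp (- lam * real d) \<le> 1 - real d / real ?F"
          unfolding lam_def by (intro exp_survival) auto
      qed
      have "(\<Sum>e\<in>free_edges n h. f (Suc k) ((Maker, e) # h))
        = 2 * (1 + q) ^ (K - Suc k) * (\<Sum>e\<in>free_edges n h. 1 / (real (card (untouched n ((Maker, e) # h))) + 2))
          + (\<Sum>e\<in>free_edges n h. projected_time n a C lam (Suc k) ((Maker, e) # h)) / real R"
        unfolding f_def sum.distrib sum_distrib_left sum_divide_distrib ..
      also have "\<dots> \<le> 2 * (1 + q) ^ (K - Suc k) * (real ?F * ((1 + q) / (real (card (untouched n h)) + 2)))
          + real ?F * projected_time n a C lam k h / real R"
        using pos 1 2 by (intro add_mono mult_left_mono divide_right_mono) auto
      also have "\<dots> = real ?F * f k h"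
        unfolding f_def pow by (simp add: algebra_simps add_divide_distrib)
      finally show "(\<Sum>e\<in>free_edges n h. f (Suc k) ((Maker, e) # h)) \<le> real ?F * f k h" .
    }
    {
      assume mod: "k mod (a + 1) = a"
      show "f (Suc k) ((Breaker, chase n h) # h) \<le> f k h"
        unfolding f_def untouched_Breaker using pos projected_time_Breaker[OF pos(3,2) mod]
        by (intro add_mono divide_right_mono mult_right_mono mult_left_mono power_increasing) auto
    }
  qed simp
  also have "measure_pmf.expectation (?P 0) (f 0) = f 0 []" by simp
  also have "\<dots> \<le> 2 * (1 + q) ^ K / (real n + 2) + (C + real n) / real R"
  proof -
    have "untouched n [] = {..<n}"
      by (auto simp: untouched_def isolated_vertex_def claimed_by_def)
    moreover have "projected_time n a C lam 0 [] \<le> C + real n"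
    proof -
      have "projected_time n a C lam 0 [] \<le> chase_time C lam a n (a - 0 mod (a + 1)) + real (0 div (a + 1))"
        using deficit_le[of n "[]"] by (intro projected_time_le pos) auto
      also have "\<dots> \<le> C + real n" using chase_time_le[OF pos(3)] by simp
      finally show ?thesis .
    qed
    ultimately show ?thesis by (simp add: f_def divide_right_mono)
  qed
  finally have bound: "measure_pmf.expectation (?P K) (f K)
      \<le> 2 * (1 + q) ^ K / (real n + 2) + (C + real n) / real R" .
  have ind: "indicator {h. \<not> secured n h} h \<le> f K h" for h
  proof (cases "secured n h")
    case True
    then show ?thesis using pos projected_time_nonneg[OF pos(3,2)] by (simp add: f_def)
  next
    case False
    show ?thesis
    proof (cases "untouched n h = {}")
      case True
      then show ?thesis using False projected_time_nonneg[OF pos(3,2), of n a K h] by (simp add: f_def)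
    next
      case ne: False
      with False have con: "contested n h" by (simp add: secured_iff contested_def)
      have "K div (a + 1) = R" by (simp add: K_def del: mult_Suc)
      with con have "real R \<le> projected_time n a C lam K h"
        using chase_time_nonneg[OF pos(3,2)] by (simp add: projected_time_def)
      then have "1 \<le> projected_time n a C lam K h / real R" using assms by simp
      then show ?thesis using False pos by (simp add: f_def add_increasing)
    qed
  qed
  have "measure_pmf.prob (random_maker_game n a (chase n)) {h. maker_wins_min_degree_1 n h}
     \<le> measure_pmf.prob (?P N) {h. \<not> secured n h}"
    unfolding random_maker_game_def card_complete_edges N_def
    by (intro measure_pmf.finite_measure_mono) (auto dest: not_secured_if_maker_wins)
  also have "\<dots> \<le> measure_pmf.prob (?P K) {h. \<not> secured n h}"
    using assms by (intro prob_not_secured_antimono[OF breaker_strategy_chase]) auto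
  also have "\<dots> = measure_pmf.expectation (?P K) (indicator {h. \<not> secured n h})" by simp
  also have "\<dots> \<le> measure_pmf.expectation (?P K) (f K)"
    using ind by (intro integral_mono_AE integrable_measure_pmf_finite) (auto intro!: AE_I2)
  also note bound
  finally show ?thesis by (simp add: q_def C_def lam_def)
qed

section \<open>Asymptotics\<close>

text \<open>
  With \<open>room\<close>, the number of free edges is so close to \<open>N\<close> that its effect on the exponent
  \<open>a N / (N - K - n)\<close> is at most \<open>1\<close>; this is the origin of \<open>exp 1\<close>. With \<open>moves\<close>, the growth of
  the untouched-vertex potential is at most \<open>exp (L / 2)\<close>, which is \<open>sqrt n\<close> for \<open>L = ln n\<close>.
\<close>

lemma failure_bound_arith:
  fixes n a R N K :: nat
  defines "K \<equiv> (a + 1) * R"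
  defines "N \<equiv> n choose 2"
  assumes room: "(real a + 1) * (real K + real n) \<le> real n ^ 2 / 8" "8 \<le> n"
    and rounds: "real n * L powr (1 - \<epsilon> / 2) \<le> real R"
    and L: "L > 1"
    and moves: "16 * real K \<le> real n * L"
    and bias: "exp (real a) \<le> L powr (1 - \<epsilon>)"
  shows "R > 0" "K + n < N"
    "2 * (1 + real n / real (N - K)) ^ K / (real n + 2)
       + (real n * exp (real a * real N / real (N - K - n)) + real n) / real R
     \<le> 2 * exp (L / 2) / real n + exp 1 * L powr (- (\<epsilon> / 2)) + L powr (- (1 - \<epsilon> / 2))"
proof -
  have "n > 0" using \<open>8 \<le> n\<close> by simp
  have "0 < real n * L powr (1 - \<epsilon> / 2)" using assms by simp
  with rounds have R: "real R > 0" by linarith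
  then show "R > 0" by simp
  have "real N = real n * (real n - 1) / 2"
    using \<open>n > 0\<close> by (simp add: N_def choose_two real_of_nat_div of_nat_diff)
  then have N: "real N \<ge> real n ^ 2 * 3 / 8"
  proof -
    have "8 * real n \<le> real n * real n" using \<open>8 \<le> n\<close> by (intro mult_right_mono) auto
    then show ?thesis
      unfolding \<open>real N = _\<close> power2_eq_square by (simp add: right_diff_distrib)
  qed
  have Kn: "real K + real n \<le> real n ^ 2 / 8"
  proof -
    have "1 * (real K + real n) \<le> (real a + 1) * (real K + real n)" by (intro mult_right_mono) auto
    also note room(1)
    finally show ?thesis by simp
  qed
  have n2: "real n ^ 2 > 0" using \<open>n > 0\<close> by simp
  have "real (K + n) < real N" using N Kn n2 by simp
  then show lt: "K + n < N" by (simp only: of_nat_less_iff)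
  then have diffs: "real (N - K) = real N - real K" "real (N - K - n) = real N - real K - real n"
    by auto
  have gap: "real (N - K) \<ge> real n ^ 2 / 4" "real (N - K - n) \<ge> real n ^ 2 / 4"
    using N Kn diffs by auto
  have "real n / real (N - K) * real K \<le> real n / (real n ^ 2 / 4) * real K"
    using gap(1) n2 by (intro mult_right_mono divide_left_mono mult_pos_pos) linarith+
  also have "\<dots> = 4 * real K / real n" using \<open>n > 0\<close> by (simp add: power2_eq_square)
  also have "\<dots> \<le> L / 2" using moves \<open>n > 0\<close> by (simp add: field_simps)
  finally have qK: "real n / real (N - K) * real K \<le> L / 2" .
  have "(1 + real n / real (N - K)) ^ K \<le> exp (real n / real (N - K)) ^ K"
    by (intro power_mono exp_ge_add_one_self) auto
  also have "\<dots> = exp (real n / real (N - K) * real K)"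
    by (simp add: exp_of_nat_mult[symmetric] mult.commute)
  also have "\<dots> \<le> exp (L / 2)" using qK by simp
  finally have 1: "2 * (1 + real n / real (N - K)) ^ K / (real n + 2) \<le> 2 * exp (L / 2) / real n"
    using \<open>n > 0\<close> by (intro frac_le) auto
  have "real a * (real K + real n) \<le> 1 * real (N - K - n)"
  proof -
    have "real a * (real K + real n) \<le> (real a + 1) * (real K + real n)" by (intro mult_right_mono) auto
    also note room(1)
    also have "real n ^ 2 / 8 \<le> 1 * real (N - K - n)" using gap n2 by simp
    finally show ?thesis .
  qed
  then have "real a * real N / real (N - K - n) \<le> real a + 1"
    using gap n2 diffs by (simp add: divide_le_eq algebra_simps)
  then have "exp (real a * real N / real (N - K - n)) \<le> exp (real a) * exp 1"
    by (simp add: exp_add[symmetric])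
  also have "\<dots> \<le> L powr (1 - \<epsilon>) * exp 1" using bias by (intro mult_right_mono) auto
  finally have "(real n * exp (real a * real N / real (N - K - n)) + real n) / real R
      \<le> (real n * (L powr (1 - \<epsilon>) * exp 1) + real n) / (real n * L powr (1 - \<epsilon> / 2))"
    using rounds L \<open>n > 0\<close>
    by (intro frac_le add_mono mult_left_mono) auto
  also have "\<dots> = exp 1 * (L powr (1 - \<epsilon>) / L powr (1 - \<epsilon> / 2)) + 1 / L powr (1 - \<epsilon> / 2)"
    using \<open>n > 0\<close> L by (simp add: field_simps)
  also have "\<dots> = exp 1 * L powr (- (\<epsilon> / 2)) + L powr (- (1 - \<epsilon> / 2))"
    by (simp only: powr_diff[symmetric] powr_minus_divide[symmetric]) simp
  finally show "2 * (1 + real n / real (N - K)) ^ K / (real n + 2)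
       + (real n * exp (real a * real N / real (N - K - n)) + real n) / real R
     \<le> 2 * exp (L / 2) / real n + exp 1 * L powr (- (\<epsilon> / 2)) + L powr (- (1 - \<epsilon> / 2))"
    using 1 by linarith
qed

text \<open>
  The number of rounds is \<open>n * (ln n) powr (1 - \<epsilon> / 2)\<close>, half way (in the exponent) between the
  \<open>n * (ln n) powr (1 - \<epsilon>)\<close> rounds that a chase needs on average and the \<open>n * ln n\<close> rounds
  after which Maker may have touched everything; the upper gap also leaves room for the factor \<open>a + 1\<close>
  between rounds and moves, which is of order \<open>ln (ln n)\<close>.
\<close>

lemma chase_failure_asymptotics:
  fixes \<epsilon> :: real and a :: "nat \<Rightarrow> nat"
  assumes eps: "\<epsilon> > 0" and a1: "\<And>n. a n \<ge> 1"
    and a: "eventually (\<lambda>n. real (a n) \<le> (1 - \<epsilon>) * ln (ln (real n))) sequentially"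
  shows "\<exists>B. B \<longlonglongrightarrow> 0 \<and> eventually (\<lambda>n. measure_pmf.prob (random_maker_game n (a n) (chase n))
            {h. maker_wins_min_degree_1 n h} \<le> B n) sequentially"
proof -
  define B where "B n = 2 * exp (ln (real n) / 2) / real n + exp 1 * ln (real n) powr (- (\<epsilon> / 2))
      + ln (real n) powr (- (1 - \<epsilon> / 2))" for n :: nat
  have lnln: "eventually (\<lambda>n. ln (ln (real n)) > 1) sequentially" by real_asymp
  have "\<epsilon> < 1"
  proof -
    from eventually_conj[OF a lnln]
    obtain n where n: "real (a n) \<le> (1 - \<epsilon>) * ln (ln (real n))" "ln (ln (real n)) > 1"
      by (auto dest: eventually_happens)
    from n(1) a1[of n] have "0 < (1 - \<epsilon>) * ln (ln (real n))" by linarith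
    with n(2) show ?thesis by (simp add: zero_less_mult_iff)
  qed
  have B: "B \<longlonglongrightarrow> 0" unfolding B_def using eps \<open>\<epsilon> < 1\<close> by real_asymp
  define r where "r n = real n * ln (real n) powr (1 - \<epsilon> / 2)" for n :: nat
  define R where "R n = nat \<lceil>r n\<rceil>" for n
  \<comment> \<open>A bound for the number of moves in these rounds, using \<open>a + 1 \<le> 2 * a \<le> 2 * ln (ln n)\<close>.\<close>
  define \<kappa> where "\<kappa> n = 2 * ln (ln (real n)) * (r n + 1)" for n
  have "eventually (\<lambda>n. (ln (ln (real n)) + 1) * (\<kappa> n + real n) \<le> real n ^ 2 / 8) sequentially"
    unfolding \<kappa>_def r_def using eps \<open>\<epsilon> < 1\<close> by real_asymp
  moreover have "eventually (\<lambda>n. 16 * \<kappa> n \<le> real n * ln (real n)) sequentially"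
    unfolding \<kappa>_def r_def using eps \<open>\<epsilon> < 1\<close> by real_asymp
  moreover have "eventually (\<lambda>n. ln (real n) > 1) sequentially" by real_asymp
  ultimately have "eventually (\<lambda>n. measure_pmf.prob (random_maker_game n (a n) (chase n))
            {h. maker_wins_min_degree_1 n h} \<le> B n) sequentially"
    using a lnln eventually_ge_at_top[of 8]
  proof eventually_elim
    case (elim n)
    define L where "L = ln (real n)"
    let ?K = "(a n + 1) * R n"
    have "(1 - \<epsilon>) * ln L \<le> 1 * ln L" using eps elim by (intro mult_right_mono) (auto simp: L_def)
    moreover have "real (a n) \<le> (1 - \<epsilon>) * ln L" using elim by (simp add: L_def)
    ultimately have aL: "real (a n) \<le> ln L" by linarith
    have "r n \<ge> 0" by (simp add: r_def)
    then have R: "r n \<le> real (R n)" "real (R n) \<le> r n + 1" unfolding R_def by linarith+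
    have "real ?K = (real (a n) + 1) * real (R n)" by (simp add: algebra_simps)
    also have "\<dots> \<le> (2 * ln L) * (r n + 1)"
      using aL a1[of n] R \<open>r n \<ge> 0\<close> by (intro mult_mono) auto
    finally have K: "real ?K \<le> \<kappa> n" by (simp add: \<kappa>_def L_def)
    have "(real (a n) + 1) * (real ?K + real n) \<le> (ln L + 1) * (\<kappa> n + real n)"
      using aL K by (intro mult_mono add_mono) auto
    with elim have room: "(real (a n) + 1) * (real ?K + real n) \<le> real n ^ 2 / 8" by (simp add: L_def)
    have "exp (real (a n)) \<le> exp ((1 - \<epsilon>) * ln L)" using elim by (simp add: L_def)
    also have "\<dots> = L powr (1 - \<epsilon>)" using elim by (simp add: powr_def L_def)
    finally have bias: "exp (real (a n)) \<le> L powr (1 - \<epsilon>)" .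
    have moves: "16 * real ?K \<le> real n * L" using K elim by (simp add: L_def)
    have "L > 1" "8 \<le> n" using elim by (auto simp: L_def)
    note * = failure_bound_arith[OF room \<open>8 \<le> n\<close> R(1)[unfolded r_def, folded L_def]
        \<open>L > 1\<close> moves bias]
    show ?case
      using order_trans[OF chase_failure_bound[OF *(1,2)] *(3)] by (simp add: B_def L_def)
  qed
  with B show ?thesis by blast
qed

theorem theorem3p1:
  fixes \<epsilon> :: real and a :: "nat \<Rightarrow> nat"
  assumes "\<epsilon> > 0"
    and "\<And>n. a n \<ge> 1"
    and "eventually (\<lambda>n. real (a n) \<le> (1 - \<epsilon>) * ln (ln (real n))) sequentially"
  shows "\<exists>S :: nat \<Rightarrow> strategy.
           (\<forall>n. breaker_strategy n (a n) (S n)) \<and>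
           (\<lambda>n. measure_pmf.prob (random_maker_game n (a n) (S n))
                  {h. breaker_wins_min_degree_1 n h}) \<longlonglongrightarrow> 1"
proof (intro exI[of _ chase] conjI allI breaker_strategy_chase)
  let ?Q = "\<lambda>n. measure_pmf.prob (random_maker_game n (a n) (chase n))"
  obtain B where B: "B \<longlonglongrightarrow> 0"
      "eventually (\<lambda>n. ?Q n {h. maker_wins_min_degree_1 n h} \<le> B n) sequentially"
    using chase_failure_asymptotics[OF assms] by blast
  have "(\<lambda>n. ?Q n {h. maker_wins_min_degree_1 n h}) \<longlonglongrightarrow> 0"
    by (rule tendsto_sandwich[OF _ B(2) tendsto_const B(1)]) simp
  then have "(\<lambda>n. 1 - ?Q n {h. maker_wins_min_degree_1 n h}) \<longlonglongrightarrow> 1 - 0"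
    by (intro tendsto_intros)
  moreover have "?Q n {h. breaker_wins_min_degree_1 n h}
      = 1 - ?Q n {h. maker_wins_min_degree_1 n h}" for n
    using measure_pmf.prob_compl[of "{h. maker_wins_min_degree_1 n h}"
        "random_maker_game n (a n) (chase n)"]
    by (simp add: breaker_wins_min_degree_1_def Compl_eq_Diff_UNIV[symmetric] Collect_neg_eq)
  ultimately show "(\<lambda>n. ?Q n {h. breaker_wins_min_degree_1 n h}) \<longlonglongrightarrow> 1" by simp
qed

end
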